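(* Let $a>1$, $m$, $s$, $k$ be positive integers, let $r=2ams-1$, and set \[ D:=m\left(2r^k+m\left(s-ar^k\right)^2\right). \] Define $q_1,\dots,q_{3k}$ by $q_{3j+1}=ar^j-1$, $q_{3j+2}=1$, $q_{3j+3}=2amr^{k-1-j}-1$ for $0\le j\le k-1$ (so the sequence is $a-1,1,2amr^{k-1}-1,\ ar-1,1,2amr^{k-2}-1,\dots,ar^{k-1}-1,1,2am-1$). Then $l(D)=6k+2$ and \[ \sqrt D=[m(ar^k-s);\overline{q_1,\dots,q_{3k},\,ar^k-s,\,q_{3k},\dots,q_1,\,2m(ar^k-s)}]. \]
   Context: For a positive non-square integer $D$, $l(D)$ denotes the length of the fundamental (shortest) period of the regular continued fraction expansion of $\sqrt D$. $[a_0;\overline{b_1,\dots,b_m}]$ denotes the regular continued fraction whose partial quotients after $a_0$ are the block $b_1,\dots,b_m$ repeated infinitely often. *)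

theory Defs
  imports Complex_Main
begin

fun cfrac_convergent :: "(nat \<Rightarrow> int) \<Rightarrow> nat \<Rightarrow> real" where
  "cfrac_convergent c 0 = of_int (c 0)"
| "cfrac_convergent c (Suc n) = of_int (c 0) + 1 / cfrac_convergent (\<lambda>i. c (Suc i)) n"

text \<open>\<open>x = [c 0; c 1, c 2, \<dots>]\<close> as an infinite regular continued fraction.\<close>

definition has_regular_cfrac :: "real \<Rightarrow> (nat \<Rightarrow> int) \<Rightarrow> bool" where
  "has_regular_cfrac x c \<longleftrightarrow> (\<forall>n\<ge>1. c n \<ge> 1) \<and> cfrac_convergent c \<longlonglongrightarrow> x"

text \<open>The partial quotients of \<open>[a0; bs, bs, \<dots>]\<close>, for a nonempty block \<open>bs\<close>.\<close>

definition periodic_cfrac :: "int \<Rightarrow> int list \<Rightarrow> nat \<Rightarrow> int" where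
  "periodic_cfrac a0 bs n = (if n = 0 then a0 else bs ! ((n - 1) mod length bs))"

text \<open>
  A regular expansion \<open>c\<close> of a given irrational number is unique, so the existential quantifier
  just names the expansion of \<open>sqrt D\<close>. The value is meaningful only if \<open>D\<close> is a positive
  non-square.
\<close>

definition sqrt_period_length :: "int \<Rightarrow> nat" where
  "sqrt_period_length D =
     (LEAST p. p > 0 \<and>
        (\<exists>c. has_regular_cfrac (sqrt (of_int D)) c \<and> (\<exists>N. \<forall>n\<ge>N. c (n + p) = c n)))"

end

theory Submission
  imports Defs
begin

text \<open>
  The complete quotients of \<open>sqrt D\<close> are \<open>(P n + sqrt D) / Q n\<close>, where \<open>P\<close> and \<open>Q\<close> obey
  \<open>P n + P (n + 1) = c n * Q n\<close> and \<open>P (n + 1)\<^sup>2 + Q n * Q (n + 1) = D\<close>; conversely, integer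
  sequences with these properties and \<open>Q > 0\<close> certify the expansion. Here they have closed forms:
  with \<open>M = m (a r\<^sup>k - s)\<close>, the indices \<open>3j, 3j + 1, 3j + 2\<close> carry (apart from \<open>P 0 = 0\<close>)
  \<open>Q = r\<^sup>j, 2 m r\<^sup>k\<^sup>-\<^sup>j, r\<^sup>j + 2 m (a r\<^sup>j - 1) (r\<^sup>k\<^sup>-\<^sup>j - s)\<close> and
  \<open>P = m (a r\<^sup>k + s) - r\<^sup>j, M, m (a r\<^sup>k + s) - 2 m r\<^sup>k\<^sup>-\<^sup>j\<close>. At index \<open>3k + 1\<close> the recurrence
  becomes symmetric, so the second half of the period is the reflection of the first. The period is
  minimal because its last entry \<open>2 M\<close> exceeds all the others, and regular expansions are unique.
\<close>

section \<open>Tails, integer parts and uniqueness of regular continued fractions\<close>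

lemma cfrac_convergent_bounds:
  assumes "\<forall>n\<ge>1. c n \<ge> 1"
  shows "of_int (c 0) \<le> cfrac_convergent c n \<and> cfrac_convergent c n \<le> of_int (c 0) + 1"
  using assms
proof (induction n arbitrary: c)
  case 0
  then show ?case by simp
next
  case (Suc n)
  have "\<forall>n\<ge>1. c (Suc n) \<ge> 1" using Suc.prems by simp
  from Suc.IH[OF this] have "of_int (c 1) \<le> cfrac_convergent (\<lambda>i. c (Suc i)) n" by simp
  moreover have "c 1 \<ge> 1" using Suc.prems by simp
  ultimately have "cfrac_convergent (\<lambda>i. c (Suc i)) n \<ge> 1" by linarith
  then have "0 < 1 / cfrac_convergent (\<lambda>i. c (Suc i)) n" "1 / cfrac_convergent (\<lambda>i. c (Suc i)) n \<le> 1"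
    by simp_all
  then show ?case unfolding cfrac_convergent.simps by linarith
qed

text \<open>The reciprocals of the tail's convergents tend to \<open>x - c 0\<close>. They are at
  least \<open>1 / (c 1 + 1)\<close>, so this limit is positive and can be inverted, which makes the
  tail itself converge.\<close>

lemma has_regular_cfrac_tail_weak:
  assumes "has_regular_cfrac x c"
  obtains y where "y \<ge> 1" "has_regular_cfrac y (\<lambda>i. c (Suc i))" "x = of_int (c 0) + 1 / y"
proof -
  let ?t = "cfrac_convergent (\<lambda>i. c (Suc i))"
  have c: "\<forall>n\<ge>1. c n \<ge> 1" and lim: "cfrac_convergent c \<longlonglongrightarrow> x"
    using assms by (auto simp: has_regular_cfrac_def)
  have c1: "real_of_int (c 1) \<ge> 1" using c by simp
  have bounds: "of_int (c 1) \<le> ?t n" "?t n \<le> of_int (c 1) + 1" for n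
    using cfrac_convergent_bounds[of "\<lambda>i. c (Suc i)" n] c by auto
  have "(\<lambda>n. cfrac_convergent c (Suc n)) \<longlonglongrightarrow> x"
    using lim by (rule LIMSEQ_Suc)
  then have "(\<lambda>n. cfrac_convergent c (Suc n) - of_int (c 0)) \<longlonglongrightarrow> x - of_int (c 0)"
    by (intro tendsto_intros)
  then have inv_lim: "(\<lambda>n. 1 / ?t n) \<longlonglongrightarrow> x - of_int (c 0)" by simp
  have "1 / (of_int (c 1) + 1) \<le> 1 / ?t n" for n
    using bounds[of n] c1 by (intro divide_left_mono mult_pos_pos) linarith+
  then have "1 / (of_int (c 1) + 1) \<le> x - of_int (c 0)"
    by (intro LIMSEQ_le_const[OF inv_lim]) blast
  moreover have "1 / (real_of_int (c 1) + 1) > 0" using c1 by simp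
  ultimately have pos: "x - of_int (c 0) > 0" by linarith
  have t_lim: "?t \<longlonglongrightarrow> 1 / (x - of_int (c 0))"
    using tendsto_divide[OF tendsto_const[of 1] inv_lim] pos by simp
  show thesis
  proof
    show "1 / (x - of_int (c 0)) \<ge> 1"
      by (rule LIMSEQ_le_const[OF t_lim]) (use bounds(1) c1 order_trans in blast)
    show "has_regular_cfrac (1 / (x - of_int (c 0))) (\<lambda>i. c (Suc i))"
      using c t_lim by (simp add: has_regular_cfrac_def)
    show "x = of_int (c 0) + 1 / (1 / (x - of_int (c 0)))" by simp
  qed
qed

text \<open>Splitting off a second quotient gives \<open>y = c 1 + 1 / z\<close> with
  \<open>1 / z > 0\<close>. This strictness is what makes \<open>c 0\<close> the floor of
  \<open>x\<close>.\<close>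

lemma has_regular_cfrac_tail:
  assumes "has_regular_cfrac x c"
  obtains y where "y > 1" "has_regular_cfrac y (\<lambda>i. c (Suc i))" "x = of_int (c 0) + 1 / y"
proof -
  obtain y where y: "has_regular_cfrac y (\<lambda>i. c (Suc i))" "x = of_int (c 0) + 1 / y"
    by (rule has_regular_cfrac_tail_weak[OF assms])
  obtain z where z: "z \<ge> 1" "y = of_int (c 1) + 1 / z"
    by (rule has_regular_cfrac_tail_weak[OF y(1)]) simp
  have "c 1 \<ge> 1" using assms by (simp add: has_regular_cfrac_def)
  moreover have "1 / z > 0" using z(1) by simp
  ultimately have "y > 1" using z(2) by linarith
  then show thesis using that y by blast
qed

lemma has_regular_cfrac_floor:
  assumes "has_regular_cfrac x c"
  shows "c 0 = \<lfloor>x\<rfloor>"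
proof -
  obtain y where "y > 1" "x = of_int (c 0) + 1 / y"
    by (rule has_regular_cfrac_tail[OF assms])
  then show ?thesis by (simp add: floor_unique)
qed

lemma has_regular_cfrac_unique:
  assumes "has_regular_cfrac x c" "has_regular_cfrac x d"
  shows "c n = d n"
  using assms
proof (induction n arbitrary: x c d)
  case 0
  then show ?case using has_regular_cfrac_floor by metis
next
  case (Suc n)
  obtain y where y: "y > 1" "has_regular_cfrac y (\<lambda>i. c (Suc i))" "x = of_int (c 0) + 1 / y"
    by (rule has_regular_cfrac_tail[OF Suc.prems(1)])
  obtain z where z: "z > 1" "has_regular_cfrac z (\<lambda>i. d (Suc i))" "x = of_int (d 0) + 1 / z"
    by (rule has_regular_cfrac_tail[OF Suc.prems(2)])
  have "c 0 = d 0" using Suc.prems has_regular_cfrac_floor by metis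
  then have "1 / y = 1 / z" using y(3) z(3) by simp
  then have "y = z" using y(1) z(1) by simp
  then show ?case using Suc.IH y(2) z(2) by blast
qed

section \<open>Minimality of the period\<close>

text \<open>The entry \<open>b\<close> occurs exactly once per block, so shifting by an eventual
  period must move one occurrence of \<open>b\<close> to another. Hence the block length divides
  every eventual period; uniqueness transfers this to whichever expansion the definition
  picks.\<close>

lemma sqrt_period_length_eq_length:
  assumes cf: "has_regular_cfrac (sqrt (of_int D)) (periodic_cfrac a0 (bs @ [b]))"
    and b: "b \<notin> set bs"
  shows "sqrt_period_length D = length (bs @ [b])"
  unfolding sqrt_period_length_def
proof (rule Least_equality)
  let ?c = "periodic_cfrac a0 (bs @ [b])"
  let ?L = "length (bs @ [b])"
  have "?c (n + ?L) = ?c n" if "n \<ge> 1" for n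
  proof -
    have "n + ?L - 1 = (n - 1) + ?L" using that by simp
    then have "(n + ?L - 1) mod ?L = (n - 1) mod ?L" by (metis mod_add_self2)
    then show ?thesis using that by (simp add: periodic_cfrac_def)
  qed
  then show "?L > 0 \<and> (\<exists>c. has_regular_cfrac (sqrt (of_int D)) c \<and> (\<exists>N. \<forall>n\<ge>N. c (n + ?L) = c n))"
    using cf by auto
next
  let ?c = "periodic_cfrac a0 (bs @ [b])"
  let ?L = "length (bs @ [b])"
  fix p
  assume "p > 0 \<and> (\<exists>c. has_regular_cfrac (sqrt (of_int D)) c \<and> (\<exists>N. \<forall>n\<ge>N. c (n + p) = c n))"
  then obtain c N where p: "p > 0" and c: "has_regular_cfrac (sqrt (of_int D)) c"
    and N: "\<forall>n\<ge>N. c (n + p) = c n" by blast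
  have "c = ?c" by (intro ext has_regular_cfrac_unique[OF c cf])
  define L where "L = ?L"
  \<comment> \<open>Index \<open>Suc n\<close> lies beyond \<open>N\<close> and carries the last
    block entry \<open>b\<close>; block position \<open>n\<close> belongs to index
    \<open>Suc n\<close> because \<open>a0\<close> occupies index 0.\<close>
  define n where "n = N * L + length bs"
  have "n \<ge> N" by (simp add: n_def L_def)
  then have "Suc n \<ge> N" by simp
  with N have "?c (Suc n + p) = ?c (Suc n)" using \<open>c = ?c\<close> by blast
  moreover have n_mod: "n mod L = length bs" unfolding n_def by (simp add: L_def del: mult_Suc_right)
  then have "?c (Suc n) = b" by (simp add: periodic_cfrac_def L_def)
  ultimately have "(bs @ [b]) ! ((n + p) mod L) = b" by (simp add: periodic_cfrac_def L_def)
  moreover have "(n + p) mod L < Suc (length bs)" by (simp add: L_def)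
  moreover have "bs ! i \<noteq> b" if "i < length bs" for i
    using b nth_mem[OF that] by metis
  ultimately have "(n + p) mod L = length bs"
    by (metis less_SucE nth_append)
  then have "(n + p) mod L = n mod L" using n_mod by simp
  then have "L dvd (n + p) - n" using mod_eq_dvd_iff_nat[of n "n + p" L] by simp
  then have "L dvd p" by simp
  then show "?L \<le> p" unfolding L_def using p by (rule dvd_imp_le)
qed

section \<open>Convergence from complete quotients\<close>

lemma abs_inverse_diff_eq:
  fixes x y :: real
  assumes "x \<ge> 1" "y \<ge> 1"
  shows "\<bar>1 / x - 1 / y\<bar> = \<bar>x - y\<bar> / (x * y)"
proof -
  have "1 / x - 1 / y = (y - x) / (x * y)" using assms by (simp add: field_simps)
  then show ?thesis using assms by (simp add: abs_divide abs_mult abs_minus_commute)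
qed

text \<open>
  A single step of the recursion need not contract, but two consecutive complete quotients have
  product at least 2, and likewise for the convergents.
\<close>

lemma cfrac_convergent_error:
  fixes x :: "nat \<Rightarrow> real"
  assumes "\<And>n. n \<ge> 1 \<Longrightarrow> c n \<ge> 1" "\<And>n. n \<ge> 1 \<Longrightarrow> x n > 0"
    and "\<And>n. x n = of_int (c n) + 1 / x (Suc n)"
  shows "\<bar>x 0 - cfrac_convergent c n\<bar> \<le> 2 * (1 / 2) ^ n"
  using assms
proof (induction n arbitrary: c x rule: less_induct)
  case (less n)
  have x1: "x i \<ge> 1" if "i \<ge> 1" for i
  proof -
    have "1 / x (Suc i) > 0" using less.prems(2) by simp
    moreover have "real_of_int (c i) \<ge> 1" using less.prems(1)[OF that] by simp
    ultimately show ?thesis using less.prems(3)[of i] by linarith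
  qed
  have conv: "cfrac_convergent (\<lambda>i. c (i + Suc j)) l \<ge> 1" for j l
  proof -
    have "real_of_int (c (Suc j)) \<ge> 1" using less.prems(1)[of "Suc j"] by simp
    moreover have "of_int (c (Suc j)) \<le> cfrac_convergent (\<lambda>i. c (i + Suc j)) l"
      using cfrac_convergent_bounds[of "\<lambda>i. c (i + Suc j)" l] less.prems(1) by simp
    ultimately show ?thesis by linarith
  qed
  \<comment> \<open>The induction goes down by two indices, hence two base cases. The factor 2 in
    the bound leaves room for an error of 1 at \<open>n = 1\<close>.\<close>
  consider "n = 0" | "n = 1" | l where "n = Suc (Suc l)" by (metis One_nat_def nat.exhaust)
  then show ?case
  proof cases
    case 1
    have "0 < 1 / x 1" "1 / x 1 \<le> 1" using x1[of 1] by simp_all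
    moreover have "x 0 = of_int (c 0) + 1 / x 1" using less.prems(3)[of 0] by simp
    moreover have "cfrac_convergent c n = of_int (c 0)" "2 * (1 / 2 :: real) ^ n = 2"
      using 1 by simp_all
    ultimately show ?thesis by linarith
  next
    case 2
    have "0 < 1 / x 1" "1 / x 1 \<le> 1" using x1[of 1] by simp_all
    moreover have "0 < 1 / real_of_int (c 1)" "1 / real_of_int (c 1) \<le> 1"
      using less.prems(1)[of 1] by simp_all
    moreover have "x 0 = of_int (c 0) + 1 / x 1" using less.prems(3)[of 0] by simp
    moreover have "cfrac_convergent c n = of_int (c 0) + 1 / of_int (c 1)" "2 * (1 / 2 :: real) ^ n = 1"
      using 2 by simp_all
    ultimately show ?thesis by linarith
  next
    case 3
    let ?d = "cfrac_convergent (\<lambda>i. c (Suc i)) (Suc l)"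
    let ?e = "cfrac_convergent (\<lambda>i. c (Suc (Suc i))) l"
    have d: "?d \<ge> 1" using conv[of 0 "Suc l"] by simp
    have e: "?e \<ge> 1" using conv[of 1 l] by simp
    have x: "x 1 \<ge> 1" "x 2 \<ge> 1" using x1 by simp_all
    have c1: "real_of_int (c 1) \<ge> 1" using less.prems(1)[of 1] by simp
    have x_eq: "x 1 = of_int (c 1) + 1 / x 2" using less.prems(3)[of 1] by (simp add: numeral_2_eq_2)
    have d_eq: "?d = of_int (c 1) + 1 / ?e" by simp
    have "x 1 * x 2 = of_int (c 1) * x 2 + 1" using x by (subst x_eq) (simp add: field_simps)
    then have xx: "x 1 * x 2 \<ge> 2" using mult_mono[OF c1 x(2)] c1 by simp
    have "?d * ?e = of_int (c 1) * ?e + 1" unfolding d_eq using e by (simp add: field_simps)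
    then have de: "?d * ?e \<ge> 2" using mult_mono[OF c1 e] c1 by simp
    have "\<bar>x 0 - cfrac_convergent c n\<bar> = \<bar>1 / x 1 - 1 / ?d\<bar>"
      using 3 less.prems(3)[of 0] by simp
    also have "\<dots> = \<bar>x 1 - ?d\<bar> / (x 1 * ?d)" using x d by (intro abs_inverse_diff_eq)
    also have "\<bar>x 1 - ?d\<bar> = \<bar>x 2 - ?e\<bar> / (x 2 * ?e)"
      using abs_inverse_diff_eq[OF x(2) e] x_eq d_eq by simp
    \<comment> \<open>Regrouping pairs consecutive quotients, so that two steps gain the factor
      1/4.\<close>
    also have "\<bar>x 2 - ?e\<bar> / (x 2 * ?e) / (x 1 * ?d) = \<bar>x 2 - ?e\<bar> / ((x 1 * x 2) * (?d * ?e))"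
      by (simp only: divide_divide_eq_left mult_ac)
    also have "\<dots> \<le> \<bar>x 2 - ?e\<bar> / (2 * 2)"
      using mult_mono[OF xx de] xx by (intro divide_left_mono) auto
    also have "\<bar>x 2 - ?e\<bar> \<le> 2 * (1 / 2) ^ l"
      unfolding numeral_2_eq_2
      by (rule less.IH[of l "\<lambda>i. c (Suc (Suc i))" "\<lambda>i. x (Suc (Suc i))", unfolded numeral_2_eq_2])
        (use 3 in simp, rule less.prems(1), simp, rule less.prems(2), simp, rule less.prems(3))
    also have "2 * (1 / 2) ^ l / (2 * 2) = 2 * (1 / 2 :: real) ^ n" using 3 by simp
    finally show ?thesis by simp
  qed
qed

text \<open>Positivity of the \<open>x n\<close> is enough: as \<open>c n \<ge> 1\<close>, the
  recursion forces \<open>x n > 1\<close> for \<open>n \<ge> 1\<close>, and the error bound gives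
  convergence.\<close>

lemma has_regular_cfracI:
  fixes x :: "nat \<Rightarrow> real"
  assumes "\<And>n. n \<ge> 1 \<Longrightarrow> c n \<ge> 1" "\<And>n. n \<ge> 1 \<Longrightarrow> x n > 0"
    and "\<And>n. x n = of_int (c n) + 1 / x (Suc n)"
  shows "has_regular_cfrac (x 0) c"
proof -
  have "\<bar>x 0 - cfrac_convergent c n\<bar> \<le> 2 * (1 / 2) ^ n" for n
    by (rule cfrac_convergent_error[of c x, OF assms])
  then have "\<forall>\<^sub>F n in sequentially. norm (cfrac_convergent c n - x 0) \<le> norm (2 * (1 / 2 :: real) ^ n) * 1"
    by (simp add: abs_minus_commute)
  moreover have "(\<lambda>n. 2 * (1 / 2 :: real) ^ n) \<longlonglongrightarrow> 0"
    by (intro tendsto_mult_right_zero LIMSEQ_power_zero) simp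
  ultimately have "(\<lambda>n. cfrac_convergent c n - x 0) \<longlonglongrightarrow> 0"
    by (rule tendsto_0_le[rotated])
  then have "cfrac_convergent c \<longlonglongrightarrow> x 0" by (rule LIM_zero_cancel)
  then show ?thesis using assms(1) by (simp add: has_regular_cfrac_def)
qed

section \<open>Expansions of square roots from integer recurrences\<close>

text \<open>Put \<open>w = sqrt D\<close> and \<open>x n = (P n + w) / Q n\<close>. By
  \<open>quad\<close>, \<open>(w - P (Suc n)) * (w + P (Suc n)) = Q n * Q (Suc n)\<close>, so
  \<open>1 / x (Suc n) = (w - P (Suc n)) / Q n\<close>; by \<open>lin\<close>, adding
  \<open>c n\<close> to this gives \<open>x n\<close>.\<close>

lemma has_regular_cfrac_sqrtI:
  fixes P Q c :: "nat \<Rightarrow> int"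
  assumes c: "\<And>n. n \<ge> 1 \<Longrightarrow> c n \<ge> 1"
    and Q: "\<And>n. Q n > 0"
    and lin: "\<And>n. P n + P (Suc n) = c n * Q n"
    and quad: "\<And>n. (P (Suc n))\<^sup>2 + Q n * Q (Suc n) = D"
    and init: "P 0 = 0" "Q 0 = 1"
  shows "has_regular_cfrac (sqrt (of_int D)) c"
proof -
  define w where "w = sqrt (real_of_int D)"
  define x where "x n = (of_int (P n) + w) / of_int (Q n)" for n
  have "D > 0" using quad[of 0] Q[of 0] Q[of 1] by (smt (verit) One_nat_def mult_pos_pos zero_le_power2)
  then have w2: "w\<^sup>2 = of_int D" by (simp add: w_def)
  have w_pos: "of_int (P (Suc n)) + w > 0" for n
  proof -
    have "(P (Suc n))\<^sup>2 < D" using quad[of n] Q[of n] Q[of "Suc n"] by (smt (verit) mult_pos_pos)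
    then have "(real_of_int (P (Suc n)))\<^sup>2 < of_int D" by (metis of_int_less_iff of_int_power)
    then have "\<bar>real_of_int (P (Suc n))\<bar> < w" unfolding w_def by (simp add: real_less_rsqrt)
    then show ?thesis by linarith
  qed
  have x_pos: "x n > 0" if "n \<ge> 1" for n
    using that w_pos[of "n - 1"] Q[of n] by (simp add: x_def)
  have x_eq: "x n = of_int (c n) + 1 / x (Suc n)" for n
  proof -
    have eq1: "w\<^sup>2 = (of_int (P (Suc n)))\<^sup>2 + of_int (Q n) * of_int (Q (Suc n))"
      unfolding w2 using quad[of n] by (metis of_int_add of_int_mult of_int_power)
    have eq2: "real_of_int (P n) = of_int (c n) * of_int (Q n) - of_int (P (Suc n))"
      using lin[of n] by (metis add_diff_cancel_right' of_int_diff of_int_mult)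
    have Q_pos: "real_of_int (Q n) > 0" using Q by simp
    have "of_int (Q (Suc n)) * of_int (Q n) = (w - of_int (P (Suc n))) * (of_int (P (Suc n)) + w)"
      using eq1 by (simp add: algebra_simps power2_eq_square)
    then have "of_int (Q (Suc n)) / (of_int (P (Suc n)) + w) = (w - of_int (P (Suc n))) / of_int (Q n)"
      using w_pos[of n] Q_pos by (subst frac_eq_eq) auto
    then have "1 / x (Suc n) = (w - of_int (P (Suc n))) / of_int (Q n)" by (simp add: x_def)
    moreover have "x n = of_int (c n) + (w - of_int (P (Suc n))) / of_int (Q n)"
      unfolding x_def eq2 using Q_pos by (simp add: field_simps)
    ultimately show ?thesis by simp
  qed
  have "has_regular_cfrac (x 0) c" by (rule has_regular_cfracI[of c x, OF c x_pos x_eq])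
  then show ?thesis by (simp add: x_def init w_def)
qed

text \<open>Both recurrences survive reversal of the indices, so half a period suffices. At the
  centre \<open>mid\<close> is the linear relation with \<open>P (h + 1) = P h\<close>; at the end
  of the period \<open>P = b 0\<close> on both sides and \<open>Q = 1\<close>, which yields the
  quotient \<open>2 * b 0\<close>.\<close>

lemma has_regular_cfrac_sqrt_palindromic:
  fixes P Q b :: "nat \<Rightarrow> int"
  assumes h: "h > 0"
    and b: "\<And>i. i \<le> h \<Longrightarrow> b i \<ge> 1"
    and Q: "\<And>i. i \<le> h \<Longrightarrow> Q i > 0"
    and lin: "\<And>i. 1 \<le> i \<Longrightarrow> i < h \<Longrightarrow> P i + P (Suc i) = b i * Q i"
    and quad: "\<And>i. i < h \<Longrightarrow> (P (Suc i))\<^sup>2 + Q i * Q (Suc i) = D"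
    and init: "P 1 = b 0" "Q 0 = 1"
    and mid: "2 * P h = b h * Q h"
  shows "has_regular_cfrac (sqrt (of_int D))
    (periodic_cfrac (b 0) (map b [1..<h] @ [b h] @ rev (map b [1..<h]) @ [2 * b 0]))"
    (is "has_regular_cfrac _ (periodic_cfrac _ ?bs)")
proof -
  \<comment> \<open>the data at index \<open>u + 1\<close> of the first period; \<open>c\<close> and \<open>Q\<close> reflect by \<open>i \<mapsto> 2h - i\<close>, but \<open>P\<close> by \<open>i \<mapsto> 2h + 1 - i\<close>\<close>
  define \<beta> where "\<beta> u = (if u < h then b (Suc u) else if Suc u = 2 * h then 2 * b 0
    else b (2 * h - Suc u))" for u
  define \<pi> where "\<pi> u = (if u < h then P (Suc u) else P (2 * h - u))" for u
  define \<kappa> where "\<kappa> u = (if u < h then Q (Suc u) else Q (2 * h - Suc u))" for u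
  have len: "length ?bs = 2 * h" using h by simp
  have nth: "?bs ! u = \<beta> u" if u: "u < 2 * h" for u
  proof -
    consider "Suc u < h" | "Suc u = h" | "h \<le> u" "Suc u < 2 * h" | "Suc u = 2 * h"
      using u by linarith
    then show ?thesis
    proof cases
      case 3
      then have "u - h < h - 1" by linarith
      then have "rev (map b [1..<h]) ! (u - h) = b (2 * h - Suc u)"
        using 3 by (simp add: rev_nth) (rule arg_cong[of _ _ b], linarith)
      moreover have "?bs ! u = (rev (map b [1..<h]) @ [2 * b 0]) ! (u - h)"
        using 3 h by (simp add: nth_append nth_Cons')
      ultimately show ?thesis using 3 \<open>u - h < h - 1\<close> by (simp add: nth_append \<beta>_def)
    qed (use h in \<open>auto simp: nth_append \<beta>_def\<close>)
  qed
  define c where "c = periodic_cfrac (b 0) ?bs"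
  have c_Suc: "c (Suc n) = \<beta> (n mod (2 * h))" for n
    using nth[of "n mod (2 * h)"] h unfolding c_def periodic_cfrac_def len by simp
  \<comment> \<open>Index 0 is treated apart: \<open>sqrt D\<close> itself has \<open>P = 0\<close>,
    whereas each full period returns to \<open>P = b 0\<close>.\<close>
  define p where "p n = (case n of 0 \<Rightarrow> 0 | Suc n \<Rightarrow> \<pi> (n mod (2 * h)))" for n
  define w where "w n = (case n of 0 \<Rightarrow> 1 | Suc n \<Rightarrow> \<kappa> (n mod (2 * h)))" for n
  have mod_step: "Suc n mod (2 * h) = (if Suc (n mod (2 * h)) = 2 * h then 0 else Suc (n mod (2 * h)))"
    for n by (rule mod_Suc)
  have lt: "n mod (2 * h) < 2 * h" for n using h by simp
  \<comment> \<open>Both recurrences around one cycle, with the last position followed by position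
    0.\<close>
  have step: "\<pi> u + \<pi> (if Suc u = 2 * h then 0 else Suc u) = \<beta> u * \<kappa> u \<and>
    (\<pi> (if Suc u = 2 * h then 0 else Suc u))\<^sup>2
      + \<kappa> u * \<kappa> (if Suc u = 2 * h then 0 else Suc u) = D" if u: "u < 2 * h" for u
  proof -
    consider "Suc u < h" | "Suc u = h" | "h \<le> u" "Suc u < 2 * h" | "Suc u = 2 * h"
      using u by linarith
    then show ?thesis
    proof cases
      case 1
      then show ?thesis using lin[of "Suc u"] quad[of "Suc u"] by (simp add: \<pi>_def \<kappa>_def \<beta>_def)
    next
      case 2
      then show ?thesis using mid quad[of u]
        by (auto simp: \<pi>_def \<kappa>_def \<beta>_def mult.commute)
    next
      case 3
      define i where "i = 2 * h - Suc (Suc u)"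
      have i: "2 * h - u = Suc (Suc i)" "2 * h - Suc u = Suc i" "2 * h - Suc (Suc u) = i"
        "Suc i < h" "i < h" using 3 by (simp_all add: i_def)
      show ?thesis using 3 i lin[of "Suc i"] quad[of i]
        by (simp add: \<pi>_def \<kappa>_def \<beta>_def add.commute mult.commute)
    next
      case 4
      then have "2 * h - u = 1" "u \<ge> h" using h by linarith+
      then show ?thesis using 4 h init quad[of 0] by (simp add: \<pi>_def \<kappa>_def \<beta>_def)
    qed
  qed
  have "has_regular_cfrac (sqrt (of_int D)) c"
  proof (rule has_regular_cfrac_sqrtI[where P = p and Q = w])
    show "c n \<ge> 1" if n: "n \<ge> 1" for n
    proof -
      obtain l where "n = Suc l" using n by (cases n) auto
      then show ?thesis using lt[of l] b[of "Suc (l mod (2 * h))"] b[of 0]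
          b[of "2 * h - Suc (l mod (2 * h))"] by (auto simp: c_Suc \<beta>_def)
    qed
    show "w n > 0" for n
      using Q[of "Suc ((n - 1) mod (2 * h))"] Q[of "2 * h - Suc ((n - 1) mod (2 * h))"]
      by (auto simp: w_def \<kappa>_def split: nat.split)
    show "p n + p (Suc n) = c n * w n" for n
    proof (cases n)
      case 0
      then show ?thesis using h init
        by (simp add: p_def w_def \<pi>_def c_def periodic_cfrac_def)
    next
      case (Suc l)
      then show ?thesis using step[OF lt[of l]] mod_step[of l] by (simp add: p_def w_def c_Suc)
    qed
    show "(p (Suc n))\<^sup>2 + w n * w (Suc n) = D" for n
    proof (cases n)
      case 0
      then show ?thesis using h init quad[of 0] by (simp add: p_def w_def \<pi>_def \<kappa>_def)
    next
      case (Suc l)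
      then show ?thesis using step[OF lt[of l]] mod_step[of l] by (simp add: p_def w_def)
    qed
  qed (simp_all add: p_def w_def)
  then show ?thesis by (simp add: c_def)
qed

section \<open>The explicit family\<close>

theorem theorem3:
  fixes a m s r D :: int and k :: nat and q :: "nat \<Rightarrow> int"
  assumes "a > 1" and "m > 0" and "s > 0" and "k > 0"
    and "r = 2 * a * m * s - 1"
    and "D = m * (2 * r ^ k + m * (s - a * r ^ k)\<^sup>2)"
    and "\<And>j. j < k \<Longrightarrow> q (3 * j + 1) = a * r ^ j - 1"
    and "\<And>j. j < k \<Longrightarrow> q (3 * j + 2) = 1"
    and "\<And>j. j < k \<Longrightarrow> q (3 * j + 3) = 2 * a * m * r ^ (k - 1 - j) - 1"
  shows "sqrt_period_length D = 6 * k + 2 \<and>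
    has_regular_cfrac (sqrt (of_int D))
      (periodic_cfrac (m * (a * r ^ k - s))
        (map q [1..<3 * k + 1] @ [a * r ^ k - s] @ rev (map q [1..<3 * k + 1])
          @ [2 * m * (a * r ^ k - s)]))"
proof -
  \<comment> \<open>The index of the central entry \<open>a * r ^ k - s\<close>.\<close>
  define h where "h = 3 * k + 1"
  define M where "M = m * (a * r ^ k - s)"
  define b where "b i = (if i = 0 then M else if i = h then a * r ^ k - s else q i)" for i
  \<comment> \<open>At index 0 the formula gives \<open>m * (a * r ^ k + s) - 1\<close> rather than
    0; the reflection lemma reads \<open>P\<close> from index 1 on.\<close>
  define P where "P i = (if i mod 3 = 0 then m * (a * r ^ k + s) - r ^ (i div 3)
    else if i mod 3 = 1 then M else m * (a * r ^ k + s) - 2 * m * r ^ (k - i div 3))" for i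
  define Q where "Q i = (if i mod 3 = 0 then r ^ (i div 3)
    else if i mod 3 = 1 then 2 * m * r ^ (k - i div 3)
    else r ^ (i div 3) + 2 * m * (a * r ^ (i div 3) - 1) * (r ^ (k - i div 3) - s))" for i
  have div_mod: "Suc (3 * j) div 3 = j" "(3 * j + 2) div 3 = j" "(3 * j + 2) mod 3 = 2" for j :: nat by presburger+
  have P_simps: "P (3 * j) = m * (a * r ^ k + s) - r ^ j" "P (3 * j + 1) = M"
    "P (3 * j + 2) = m * (a * r ^ k + s) - 2 * m * r ^ (k - j)" for j
    by (simp_all add: P_def div_mod del: add_2_eq_Suc')
  have Q_simps: "Q (3 * j) = r ^ j" "Q (3 * j + 1) = 2 * m * r ^ (k - j)"
    "Q (3 * j + 2) = r ^ j + 2 * m * (a * r ^ j - 1) * (r ^ (k - j) - s)" for j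
    by (simp_all add: Q_def div_mod del: add_2_eq_Suc')
  have ms: "m * s \<ge> 1" and ms_s: "m * s \<ge> s"
    using assms(2,3) by (simp_all add: int_one_le_iff_zero_less)
  have "a * (m * s) \<ge> 2 * (m * s)" using assms(1) ms by (intro mult_right_mono) auto
  then have r_ms: "r \<ge> 4 * (m * s) - 1" using assms(5) by (simp add: algebra_simps)
  then have r3: "r \<ge> 3" and r_s: "r > s" using ms ms_s by linarith+
  have r_pow: "r ^ j \<ge> 1" for j using r3 by simp
  have r_pow_s: "r ^ j > s" if "j > 0" for j
    using self_le_power[of r j] that r3 r_s by linarith
  have a_pow: "a * r ^ j \<ge> 2 * r ^ j" for j using assms(1) r_pow[of j] by (intro mult_right_mono) auto
  have m_mult: "m * z \<ge> z" if "z \<ge> 0" for z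
    using mult_right_mono[of 1 m z] that assms(2) by simp
  \<comment> \<open>This is the quadratic relation wherever \<open>P = M\<close>: there the two
    adjacent \<open>Q\<close> are \<open>r ^ j\<close> and
    \<open>2 * m * r ^ (k - j)\<close>.\<close>
  have D: "D = M\<^sup>2 + 2 * m * r ^ k"
    unfolding assms(6) M_def by (simp add: algebra_simps power2_eq_square)
  have split: "r ^ j * r ^ (k - j) = r ^ k" if "j \<le> k" for j
    using that by (simp flip: power_add)
  have mid_pos: "a * r ^ k - s \<ge> 1" using a_pow[of k] r_pow_s[of k] r_pow[of k] assms(4) by linarith
  have M_pos: "M \<ge> 1" using m_mult[of "a * r ^ k - s"] mid_pos unfolding M_def by linarith
  \<comment> \<open>Residue 0 is written \<open>3 * j + 3\<close>, so that all three cases share the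
    range \<open>j < k\<close> of the formulas for \<open>q\<close>.\<close>
  have index: thesis
    if "1 \<le> i" "i < h" "\<And>j. j < k \<Longrightarrow> i = 3 * j + 1 \<Longrightarrow> thesis"
      "\<And>j. j < k \<Longrightarrow> i = 3 * j + 2 \<Longrightarrow> thesis" "\<And>j. j < k \<Longrightarrow> i = 3 * j + 3 \<Longrightarrow> thesis" for i thesis
  proof -
    have "(i - 1) div 3 < k \<and> (i = 3 * ((i - 1) div 3) + 1 \<or> i = 3 * ((i - 1) div 3) + 2
      \<or> i = 3 * ((i - 1) div 3) + 3)"
      using that(1,2) unfolding h_def by presburger
    then show thesis using that(3-5) by blast
  qed
  have q_bounds: "1 \<le> q i \<and> q i < 2 * M" if "1 \<le> i" "i < h" for i
  proof -
    obtain l where l: "k = Suc l" using assms(4) by (cases k) auto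
    have pow_le: "r ^ j \<le> r ^ l" if "j \<le> l" for j using that r3 by (intro power_increasing) auto
    \<comment> \<open>The largest \<open>q i\<close> is \<open>2 * a * m * r ^ l - 1\<close>. The
      bound holds because \<open>a * r ^ k - a * r ^ l = (r - 1) * (a * r ^ l) \<ge> 2 * (r - 1)
      \<ge> s\<close>.\<close>
    have big: "2 * (m * (a * r ^ l)) \<le> 2 * M"
    proof -
      have "(r - 1) * 2 \<le> (r - 1) * (a * r ^ l)"
        using a_pow[of l] r_pow[of l] r3 by (intro mult_left_mono) linarith+
      then have "a * r ^ l \<le> a * r ^ k - s"
        using r3 r_s unfolding l by (simp add: algebra_simps)
      then show ?thesis unfolding M_def using assms(2) by simp
    qed
    show ?thesis
    proof (rule index[OF that])
      fix j assume j: "j < k" "i = 3 * j + 1"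
      have "a * r ^ j \<le> a * r ^ l" using pow_le[of j] j l assms(1) by (intro mult_left_mono) auto
      moreover have "q i = a * r ^ j - 1" using j assms(7) by simp
      moreover have "a * r ^ j \<ge> 2" using a_pow[of j] r_pow[of j] by linarith
      ultimately show ?thesis using big m_mult[of "a * r ^ l"] by linarith
    next
      fix j assume j: "j < k" "i = 3 * j + 2"
      then show ?thesis using assms(8)[OF j(1)] M_pos by auto
    next
      fix j assume j: "j < k" "i = 3 * j + 3"
      have "k - 1 - j \<le> l" using l by simp
      then have "m * (a * r ^ (k - 1 - j)) \<le> m * (a * r ^ l)"
        using pow_le assms(1,2) by (intro mult_left_mono) auto
      moreover have "m * (a * r ^ (k - 1 - j)) \<ge> 2"
        using m_mult[of "a * r ^ (k - 1 - j)"] a_pow[of "k - 1 - j"] r_pow[of "k - 1 - j"] by linarith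
      ultimately show ?thesis using j assms(9)[OF j(1)] big by (simp add: algebra_simps)
    qed
  qed
  have map_b: "map b [1..<h] = map q [1..<3 * k + 1]" by (simp add: b_def h_def)
  have b_ends: "b 0 = m * (a * r ^ k - s)" "b h = a * r ^ k - s"
    by (simp_all add: b_def h_def M_def)
  have "has_regular_cfrac (sqrt (of_int D))
    (periodic_cfrac (b 0) (map b [1..<h] @ [b h] @ rev (map b [1..<h]) @ [2 * b 0]))"
  proof (rule has_regular_cfrac_sqrt_palindromic[where P = P and Q = Q])
    show "h > 0" by (simp add: h_def)
    show "b i \<ge> 1" if "i \<le> h" for i
      using q_bounds[of i] M_pos mid_pos that by (auto simp: b_def)
    \<comment> \<open>As \<open>h = 3 * k + 1\<close>, \<open>Q h = 2 * m * r ^ 0\<close>, and the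
      central condition reads \<open>2 * M = (a * r ^ k - s) * (2 * m)\<close>.\<close>
    show "P 1 = b 0" "Q 0 = 1" "2 * P h = b h * Q h"
      by (simp_all add: P_def Q_def b_def h_def M_def)
    show "Q i > 0" if "i \<le> h" for i
    proof -
      have "r ^ j + 2 * m * (a * r ^ j - 1) * (r ^ (k - j) - s) > 0" if "j < k" for j
      proof -
        have "a * r ^ j - 1 \<ge> 0" using a_pow[of j] r_pow[of j] by linarith
        moreover have "r ^ (k - j) - s \<ge> 0" using r_pow_s[of "k - j"] that by simp
        ultimately have "2 * m * (a * r ^ j - 1) * (r ^ (k - j) - s) \<ge> 0" using assms(2) by simp
        then show ?thesis using r_pow[of j] by linarith
      qed
      moreover have "i div 3 < k" if "i mod 3 \<noteq> 0" "i mod 3 \<noteq> 1"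
        using that \<open>i \<le> h\<close> unfolding h_def by presburger
      ultimately show ?thesis using r3 assms(2) by (simp add: Q_def)
    qed
    show "P i + P (Suc i) = b i * Q i" if "1 \<le> i" "i < h" for i
    proof (rule index[OF that])
      fix j assume j: "j < k" "i = 3 * j + 1"
      have Suc_i: "Suc i = 3 * j + 2" using j by simp
      have b_i: "b i = a * r ^ j - 1" using j that assms(7) by (simp add: b_def)
      have K: "r ^ k = r ^ j * r ^ (k - j)" using split[of j] j by simp
      show ?thesis unfolding b_i unfolding Suc_i unfolding j(2) P_simps Q_simps M_def K
        by (simp add: algebra_simps)
    next
      fix j assume j: "j < k" "i = 3 * j + 2"
      have Suc_i: "Suc i = 3 * Suc j" using j by simp
      have b_i: "b i = 1" using j that assms(8) by (simp add: b_def)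
      have K: "r ^ k = r ^ j * r ^ (k - j)" using split[of j] j by simp
      \<comment> \<open>Here \<open>R = r ^ j\<close> and \<open>U = r ^ (k - j)\<close>. The two
        sides differ only in the coefficient of \<open>R\<close>, where
        \<open>- r = 1 - 2 * a * m * s\<close> is the definition of \<open>r\<close>.\<close>
      have "m * (a * (R * U) + s) - 2 * m * U + (m * (a * (R * U) + s) - r * R) =
          1 * (R + 2 * m * (a * R - 1) * (U - s))" for R U
        unfolding assms(5) by (simp add: algebra_simps)
      then show ?thesis unfolding b_i unfolding Suc_i unfolding j(2) P_simps Q_simps K power_Suc .
    next
      fix j assume j: "j < k" "i = 3 * j + 3"
      have i: "i = 3 * Suc j" "Suc i = 3 * Suc j + 1" using j by simp_all
      have b_i: "b i = 2 * a * m * r ^ (k - Suc j) - 1" using j that assms(9) by (simp add: b_def)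
      have K: "r ^ k = r ^ Suc j * r ^ (k - Suc j)" using split[of "Suc j"] j by simp
      show ?thesis unfolding b_i unfolding i(2) unfolding i(1) P_simps Q_simps M_def K
        by (simp add: algebra_simps)
    qed
    show "(P (Suc i))\<^sup>2 + Q i * Q (Suc i) = D" if i: "i < h" for i
    proof -
      define j where "j = i div 3"
      \<comment> \<open>Only residue 0 allows \<open>j = k\<close>: this is the step from
        \<open>3 * k\<close> to the centre \<open>h\<close>.\<close>
      consider "i = 3 * j" "j \<le> k" | "i = 3 * j + 1" "j < k" | "i = 3 * j + 2" "j < k"
        using i unfolding j_def h_def by atomize_elim presburger
      then show ?thesis
      proof cases
        case 1
        then have "Suc i = 3 * j + 1" by simp
        then show ?thesis using 1 P_simps(2)[of j] Q_simps(1,2)[of j] split[of j] D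
          by (simp add: algebra_simps)
      next
        case 2
        then have Suc_i: "Suc i = 3 * j + 2" by simp
        have K: "r ^ k = r ^ j * r ^ (k - j)" using split[of j] 2 by simp
        show ?thesis unfolding Suc_i unfolding 2(1) P_simps Q_simps D M_def K
          by (simp add: algebra_simps power2_eq_square)
      next
        case 3
        then have Suc_i: "Suc i = 3 * Suc j" by simp
        have K: "r ^ k = r ^ j * r ^ (k - j)" using split[of j] 3 by simp
        \<comment> \<open>Left side minus \<open>M\<^sup>2\<close> is \<open>2 * m * R * U * (2 * a
          * m * s - r) + r * R\<^sup>2 * (r + 1 - 2 * a * m * s)\<close>; by the choice of
          \<open>r\<close> the brackets are 1 and 0.\<close>
        have "(m * (a * (R * U) + s) - r * R)\<^sup>2 + (R + 2 * m * (a * R - 1) * (U - s)) * (r * R) =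
          (m * (a * (R * U) - s))\<^sup>2 + 2 * m * (R * U)" for R U
          unfolding assms(5) by (simp add: algebra_simps power2_eq_square)
        then show ?thesis unfolding Suc_i unfolding 3(1) P_simps Q_simps D M_def K power_Suc .
      qed
    qed
  qed
  then have cf: "has_regular_cfrac (sqrt (of_int D))
      (periodic_cfrac (m * (a * r ^ k - s))
        (map q [1..<3 * k + 1] @ [a * r ^ k - s] @ rev (map q [1..<3 * k + 1])
          @ [2 * m * (a * r ^ k - s)]))"
    by (simp only: map_b b_ends mult.assoc)
  have mid_lt: "a * r ^ k - s < 2 * M"
    using m_mult[of "a * r ^ k - s"] mid_pos unfolding M_def by linarith
  have not_in: "2 * M \<notin> set (map q [1..<3 * k + 1] @ [a * r ^ k - s] @ rev (map q [1..<3 * k + 1]))"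
  proof -
    have "2 * M \<noteq> q i" if "i \<in> {1..<3 * k + 1}" for i
      using q_bounds[of i] that by (simp add: h_def)
    then have "2 * M \<notin> q ` {1..<3 * k + 1}" by blast
    moreover have "2 * M \<noteq> a * r ^ k - s" using mid_lt by simp
    ultimately show ?thesis by (simp only: set_append set_rev set_map set_upt list.set) simp
  qed
  have "sqrt_period_length D =
      length ((map q [1..<3 * k + 1] @ [a * r ^ k - s] @ rev (map q [1..<3 * k + 1])) @ [2 * M])"
    by (rule sqrt_period_length_eq_length[OF _ not_in])
      (use cf in \<open>simp only: M_def mult.assoc append_assoc\<close>)
  then show ?thesis using cf by simp
qed

end
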